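(* Let $0\le k<n<N$ be integers, let $H^N=[0,1]^N$, and let $A$ be an $n\times N$ random matrix with an orthant-symmetric and generic random nullspace. Then $$\frac{\mathcal{E}f_k(AH^N)}{f_k(H^N)}=1-P_{N-n,N-k},$$ where, for positive integers $m,M$, $$P_{m,M}=2^{-M+1}\sum_{\ell=0}^{m-1}\binom{M-1}{\ell}.$$
   Context: For a polyhedron $Q$, $f_k(Q)$ denotes the number of $k$-dimensional faces of $Q$; $AQ$ is the image of $Q$ under $A$; $\mathcal{E}$ denotes expectation. A random $(N-n)\times N$ matrix $B$ is orthant-symmetric if for each diagonal matrix $S$ with diagonal in $\{-1,1\}^N$ and every measurable set $\Omega$, $\mathrm{Prob}\{BS\in\Omega\}=\mathrm{Prob}\{B\in\Omega\}$. Let $V_B$ be the linear span of the rows of $B$. If $B$ is orthant-symmetric, $V_B$ is called an orthant-symmetric random subspace. If every subset of $N-n$ columns of $B$ is almost surely linearly independent, $V_B$ is called a generic random subspace. A random $n\times N$ matrix $A$ has an orthant-symmetric and generic nullspace if its nullspace $\mathcal{N}(A)$ equals $V_B$ for a random matrix $B$ having both properties. *)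

theory Defs
  imports "HOL-Probability.Probability"
begin

definition num_faces :: "nat \<Rightarrow> 'a::euclidean_space set \<Rightarrow> nat" where
  "num_faces k Q = card {F. F face_of Q \<and> aff_dim F = int k}"

definition unit_hypercube :: "(real ^ 'N) set" where
  "unit_hypercube = {x. \<forall>i. 0 \<le> x $ i \<and> x $ i \<le> 1}"

definition sign_diagonal :: "real ^ 'N ^ 'N \<Rightarrow> bool" where
  "sign_diagonal S \<longleftrightarrow> (\<forall>i j. i \<noteq> j \<longrightarrow> S $ i $ j = 0) \<and> (\<forall>i. S $ i $ i \<in> {-1, 1})"

definition orthant_symmetric :: "'a measure \<Rightarrow> ('a \<Rightarrow> real ^ 'N ^ 'm) \<Rightarrow> bool" where
  "orthant_symmetric M B \<longleftrightarrow>
    (\<forall>S. sign_diagonal S \<longrightarrow>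
      (\<forall>\<Omega> \<in> sets borel.
        measure M {\<omega> \<in> space M. B \<omega> ** S \<in> \<Omega>} = measure M {\<omega> \<in> space M. B \<omega> \<in> \<Omega>}))"

definition row_space :: "real ^ 'N ^ 'm \<Rightarrow> (real ^ 'N) set" where
  "row_space B = span (rows B)"

definition nullspace :: "real ^ 'N ^ 'n \<Rightarrow> (real ^ 'N) set" where
  "nullspace A = {x. A *v x = 0}"

text \<open>
  Independence of the columns is independence of the indexed family, so the chosen columns
  must also be pairwise distinct (\<^const>\<open>independent\<close> only sees the set of columns).
\<close>

definition generic_columns :: "'a measure \<Rightarrow> ('a \<Rightarrow> real ^ 'N ^ 'm) \<Rightarrow> bool" where
  "generic_columns M B \<longleftrightarrow>
    (\<forall>J :: 'N set. card J = CARD('m) \<longrightarrow>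
      (AE \<omega> in M. inj_on (\<lambda>j. column j (B \<omega>)) J \<and>
                  independent ((\<lambda>j. column j (B \<omega>)) ` J)))"

text \<open>
  A random \<open>n \<times> N\<close> matrix \<open>A\<close> has an orthant-symmetric and generic nullspace if there is a
  random \<open>(N - n) \<times> N\<close> matrix \<open>B\<close>, on the same probability space, that is orthant-symmetric and
  generic and whose row space is almost surely the nullspace of \<open>A\<close>. The number of rows of \<open>B\<close>
  is the cardinality of a type, which cannot be bound by an existential quantifier, so the
  witness \<open>B\<close> is an argument of the predicate.
\<close>

definition orthant_symmetric_generic_nullspace ::
    "'a measure \<Rightarrow> ('a \<Rightarrow> real ^ 'N ^ 'n) \<Rightarrow> ('a \<Rightarrow> real ^ 'N ^ 'm) \<Rightarrow> bool" where
  "orthant_symmetric_generic_nullspace M A B \<longleftrightarrow>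
    CARD('n) + CARD('m) = CARD('N) \<and>
    B \<in> borel_measurable M \<and> orthant_symmetric M B \<and> generic_columns M B \<and>
    (AE \<omega> in M. nullspace (A \<omega>) = row_space (B \<omega>))"

text \<open>Only used for positive \<open>m\<close> and \<open>L\<close>.\<close>

definition Pcoeff :: "nat \<Rightarrow> nat \<Rightarrow> real" where
  "Pcoeff m L = 2 powi (- int L + 1) * (\<Sum>l = 0..m - 1. real ((L - 1) choose l))"

end

theory Submission
  imports Defs
begin

text \<open>
  Faces of the zonotope \<open>A H\<^sup>N\<close> are exposed, so they correspond to the sign vectors of
  the elements of the row space \<open>L\<close> of \<open>A\<close>: the zero set of a sign vector is the set of free
  coordinates of the corresponding cube face. Almost surely \<open>L = {x. B x = 0}\<close> is in general
  position with respect to the coordinate hyperplanes. Then a face has dimension \<open>k < n\<close> exactly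
  when its zero set has \<open>k\<close> elements, and for each zero set the sign vectors are the cells of a
  generic arrangement of \<open>N - k\<close> hyperplanes in dimension \<open>n - k\<close>, of which there are
  \<open>2 * (\<Sum>l<n - k. (N - k - 1) choose l)\<close>. Hence the number of faces is almost surely constant.
  The expectation also needs the number of faces to be a Borel function of \<open>A\<close> everywhere, since
  the integral of a non-measurable function is \<open>0\<close> by convention.
\<close>

section \<open>Cells of a generic subspace\<close>

definition vanishing :: "'N set \<Rightarrow> (real ^ 'N) set" where
  "vanishing S = {x. \<forall>i\<in>S. x $ i = 0}"

lemma subspace_vanishing: "subspace (vanishing S)"
  by (auto simp: vanishing_def subspace_def)

lemma vanishing_Un: "vanishing (S \<union> T) = vanishing S \<inter> vanishing T"
  by (auto simp: vanishing_def)

lemma vanishing_empty [simp]: "vanishing {} = UNIV"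
  by (simp add: vanishing_def)

lemma vanishing_UNIV [simp]: "vanishing UNIV = {0}"
  by (auto simp: vanishing_def vec_eq_iff)

lemma dim_Int_vanishing_insert:
  assumes W: "subspace W" and x: "x \<in> W" "x $ j \<noteq> 0"
  shows "dim W = Suc (dim (W \<inter> vanishing {j}))"
proof -
  let ?V = "W \<inter> vanishing {j}"
  have V: "subspace ?V"
    by (intro subspace_inter W subspace_vanishing)
  have "x \<notin> span ?V"
    using V x by (simp add: span_eq_iff[THEN iffD2] vanishing_def)
  moreover have "span (insert x ?V) = W"
  proof
    show "span (insert x ?V) \<subseteq> W"
      using x W by (intro span_minimal) auto
    show "W \<subseteq> span (insert x ?V)"
    proof
      fix w assume w: "w \<in> W"
      let ?c = "w $ j / x $ j"
      have "w - ?c *\<^sub>R x \<in> ?V"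
        using w x W by (simp add: vanishing_def subspace_diff subspace_scale)
      then show "w \<in> span (insert x ?V)"
        by (auto simp: span_insert intro!: exI[of _ ?c] span_base)
    qed
  qed
  ultimately show ?thesis
    by (metis dim_insert dim_span Suc_eq_plus1)
qed

lemma dim_le_dim_Int_vanishing:
  assumes "finite D" "subspace W"
  shows "dim W \<le> dim (W \<inter> vanishing D) + card D"
  using assms
proof (induction D arbitrary: W rule: finite_induct)
  case (insert j D)
  let ?V = "W \<inter> vanishing {j}"
  have V: "subspace ?V"
    by (intro subspace_inter insert.prems subspace_vanishing)
  have "dim W \<le> Suc (dim ?V)"
  proof (cases "\<exists>x\<in>W. x $ j \<noteq> 0")
    case False
    then have "?V = W" by (auto simp: vanishing_def)
    then show ?thesis by simp
  qed (use dim_Int_vanishing_insert[OF insert.prems] in auto)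
  moreover have "?V \<inter> vanishing D = W \<inter> vanishing (insert j D)"
    by (auto simp: vanishing_def)
  ultimately show ?case
    using insert.IH[OF V] insert.hyps by simp
qed simp

text \<open>General position with respect to the coordinate hyperplanes: any \<open>dim W\<close> of
  the coordinate functionals restrict to a basis of the dual of \<open>W\<close>, so they form a
  uniform matroid.\<close>

definition generic_subspace :: "(real ^ 'N) set \<Rightarrow> bool" where
  "generic_subspace W \<longleftrightarrow>
    subspace W \<and> (\<forall>S. card S = dim W \<longrightarrow> W \<inter> vanishing S = {0})"

text \<open>Each hyperplane lowers the dimension by at most one. Enlarging \<open>S\<close> to
  \<open>dim W\<close> coordinates must bring it down to 0, so no hyperplane on the way may fail to
  lower it. For larger \<open>S\<close> both sides are 0, by truncated subtraction.\<close>

lemma dim_Int_vanishing: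
  fixes W :: "(real ^ 'N) set"
  assumes W: "generic_subspace W"
  shows "dim (W \<inter> vanishing S) = dim W - card S"
proof (cases "card S \<le> dim W")
  case True
  have sub: "subspace W" using W by (simp add: generic_subspace_def)
  have "dim W \<le> CARD('N)"
    using dim_subset_UNIV[of W] by simp
  then obtain T where T: "S \<subseteq> T" "card T = dim W"
    using True exists_subset_between[of S "dim W" UNIV] by auto
  have "dim (W \<inter> vanishing S) \<le> dim (W \<inter> vanishing S \<inter> vanishing (T - S)) + card (T - S)"
    by (intro dim_le_dim_Int_vanishing subspace_inter sub subspace_vanishing) simp
  also have "W \<inter> vanishing S \<inter> vanishing (T - S) = W \<inter> vanishing T"
    using T(1) by (auto simp: vanishing_def)
  also have "\<dots> = {0}"
    using W T by (simp add: generic_subspace_def)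
  finally have "dim (W \<inter> vanishing S) \<le> dim W - card S"
    using T by (simp add: card_Diff_subset)
  then show ?thesis
    using dim_le_dim_Int_vanishing[OF _ sub, of S] by simp
next
  case False
  then obtain T where T: "T \<subseteq> S" "card T = dim W"
    by (metis nat_le_linear obtain_subset_with_card_n)
  then have "W \<inter> vanishing S \<subseteq> W \<inter> vanishing T"
    by (auto simp: vanishing_def)
  also have "\<dots> = {0}"
    using W T by (simp add: generic_subspace_def)
  finally show ?thesis
    using False by (metis dim_eq_0 diff_is_0_eq nat_le_linear)
qed

text \<open>The cells cut out in \<open>W\<close> by the coordinate hyperplanes indexed by \<open>K\<close>, each cell being
  encoded by its set of positive coordinates.\<close>

definition regions :: "(real ^ 'N) set \<Rightarrow> 'N set \<Rightarrow> 'N set set" where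
  "regions W K = {P. \<exists>x\<in>W. (\<forall>i\<in>K. x $ i \<noteq> 0) \<and> P = {i \<in> K. x $ i > 0}}"

lemma regions_subset: "regions W K \<subseteq> Pow K"
  by (auto simp: regions_def)

lemma in_regions_iff:
  "P \<in> regions W K \<longleftrightarrow>
    P \<subseteq> K \<and> (\<exists>x\<in>W. (\<forall>i\<in>P. x $ i > 0) \<and> (\<forall>i\<in>K - P. x $ i < 0))"
  (is "?l = ?r")
proof
  show "?l \<Longrightarrow> ?r" by (force simp: regions_def)
next
  assume ?r
  then obtain x where P: "P \<subseteq> K" and x: "x \<in> W" "\<forall>i\<in>P. x $ i > 0" "\<forall>i\<in>K - P. x $ i < 0"
    by blast
  have sgn: "x $ i \<noteq> 0 \<and> (i \<in> P \<longleftrightarrow> x $ i > 0)" if "i \<in> K" for i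
  proof (cases "i \<in> P")
    case True
    then show ?thesis using x(2) by auto
  next
    case False
    then have "x $ i < 0" using x(3) that by blast
    then show ?thesis using False by auto
  qed
  then have "P = {i \<in> K. x $ i > 0}" using P by blast
  then show ?l
    unfolding regions_def using sgn x(1) by blast
qed

lemma regions_restrict: "P \<in> regions W K \<Longrightarrow> K' \<subseteq> K \<Longrightarrow> P \<inter> K' \<in> regions W K'"
  unfolding in_regions_iff by (elim conjE bexE, intro conjI bexI) auto

text \<open>Finitely many strict inequalities survive a short move. This pushes a point off a
  further hyperplane without leaving its cell.\<close>

lemma small_perturbation:
  fixes x v :: "real ^ 'N"
  assumes "\<forall>i\<in>P. x $ i > 0" "\<forall>i\<in>Q. x $ i < 0"
  obtains e where "e > 0" "\<forall>i\<in>P. (x + e *\<^sub>R v) $ i > 0" "\<forall>i\<in>Q. (x + e *\<^sub>R v) $ i < 0"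
proof -
  have t: "((\<lambda>e. (x + e *\<^sub>R v) $ i) \<longlongrightarrow> x $ i) (at_right 0)" for i
  proof -
    have "((\<lambda>e. (x + e *\<^sub>R v) $ i) \<longlongrightarrow> (x + 0 *\<^sub>R v) $ i) (at_right 0)"
      by (intro tendsto_intros)
    then show ?thesis by simp
  qed
  have "eventually (\<lambda>e. \<forall>i\<in>P. (x + e *\<^sub>R v) $ i > 0) (at_right 0)"
    by (intro eventually_ball_finite ballI order_tendstoD(1)[OF t]) (use assms in auto)
  moreover have "eventually (\<lambda>e. \<forall>i\<in>Q. (x + e *\<^sub>R v) $ i < 0) (at_right 0)"
    by (intro eventually_ball_finite ballI order_tendstoD(2)[OF t]) (use assms in auto)
  moreover have "eventually (\<lambda>e::real. e > 0) (at_right 0)"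
    by (simp add: eventually_at_right_less)
  ultimately have "eventually (\<lambda>e. e > 0 \<and> (\<forall>i\<in>P. (x + e *\<^sub>R v) $ i > 0) \<and>
      (\<forall>i\<in>Q. (x + e *\<^sub>R v) $ i < 0)) (at_right 0)"
    by eventually_elim auto
  then show thesis
    using that eventually_happens'[OF trivial_limit_at_right_real] by blast
qed

text \<open>Deletion and restriction: the hyperplane of \<open>j\<close> cuts a cell of
  \<open>K\<close> in two exactly when it meets it, that is, when the cell comes from the
  restriction. \<open>X\<close> and \<open>Y\<close> collect the cells of \<open>K\<close> with
  points on the negative and on the positive side; their union is all cells of \<open>K\<close>,
  their intersection the cells that are cut.\<close>

lemma card_regions_insert:
  fixes W :: "(real ^ 'N) set"
  assumes W: "subspace W" and v: "v \<in> W" "v $ j \<noteq> 0" and j: "j \<notin> K"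
  shows "card (regions W (insert j K)) =
    card (regions W K) + card (regions (W \<inter> vanishing {j}) K)"
proof -
  let ?R = "regions W (insert j K)"
  define X where "X = {P \<in> ?R. j \<notin> P}"
  define Y where "Y = {P. j \<notin> P \<and> insert j P \<in> ?R}"
  have fin: "finite A" for A :: "'N set set" by simp
  have jK: "j \<notin> P" if "P \<in> regions V K" for V P
    using that j regions_subset by blast
  have inj: "inj_on (insert j) Y"
    by (rule inj_onI) (auto simp: Y_def)
  have "?R = X \<union> insert j ` Y"
  proof (intro equalityI subsetI)
    fix P assume P: "P \<in> ?R"
    show "P \<in> X \<union> insert j ` Y"
    proof (cases "j \<in> P")
      case True
      then have "insert j (P - {j}) = P" by auto
      then show ?thesis using P by (intro UnI2 image_eqI[of _ _ "P - {j}"]) (auto simp: Y_def)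
    qed (use P in \<open>simp add: X_def\<close>)
  qed (auto simp: X_def Y_def)
  moreover have "X \<inter> insert j ` Y = {}" by (auto simp: X_def)
  ultimately have "card ?R = card X + card (insert j ` Y)"
    by (simp add: card_Un_disjoint)
  then have R: "card ?R = card X + card Y"
    by (simp add: card_image inj)
  have "X \<union> Y = regions W K"
  proof (intro equalityI subsetI)
    fix P assume P: "P \<in> X \<union> Y"
    then have PK: "P \<subseteq> K" by (auto simp: X_def Y_def in_regions_iff)
    have "P \<inter> K \<in> regions W K \<or> insert j P \<inter> K \<in> regions W K"
      using P regions_restrict[of _ W "insert j K" K] by (auto simp: X_def Y_def)
    moreover have "P \<inter> K = P" "insert j P \<inter> K = P" using PK j by auto
    ultimately show "P \<in> regions W K" by simp
  next
    fix P assume P: "P \<in> regions W K"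
    then obtain x where x: "x \<in> W" "\<forall>i\<in>P. x $ i > 0" "\<forall>i\<in>K - P. x $ i < 0" and PK: "P \<subseteq> K"
      by (auto simp: in_regions_iff)
    \<comment> \<open>A point of the cell that lies on the hyperplane of \<open>j\<close> is moved
      off it along \<open>v\<close>.\<close>
    obtain y where y: "y \<in> W" "\<forall>i\<in>P. y $ i > 0" "\<forall>i\<in>K - P. y $ i < 0" "y $ j \<noteq> 0"
    proof (cases "x $ j = 0")
      case True
      obtain e where e: "e > 0" "\<forall>i\<in>P. (x + e *\<^sub>R v) $ i > 0" "\<forall>i\<in>K - P. (x + e *\<^sub>R v) $ i < 0"
        by (rule small_perturbation[OF x(2,3)])
      show thesis
        by (rule that[of "x + e *\<^sub>R v"])
          (use e True v x W in \<open>auto simp: subspace_add subspace_scale\<close>)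
    qed (use x that in auto)
    show "P \<in> X \<union> Y"
    proof (cases "y $ j > 0")
      case True
      then have "insert j P \<in> ?R"
        using y PK by (auto simp: in_regions_iff intro!: bexI[of _ y])
      then show ?thesis using jK[OF P] by (simp add: Y_def)
    next
      case False
      then have "P \<in> ?R"
        using y PK by (auto simp: in_regions_iff intro!: bexI[of _ y])
      then show ?thesis using jK[OF P] by (simp add: X_def)
    qed
  qed
  moreover have "X \<inter> Y = regions (W \<inter> vanishing {j}) K"
  proof (intro equalityI subsetI)
    fix P assume P: "P \<in> X \<inter> Y"
    then have jP: "j \<notin> P" and PK: "P \<subseteq> K" by (auto simp: X_def Y_def in_regions_iff)
    from P jP obtain x where x: "x \<in> W" "\<forall>i\<in>P. x $ i > 0" "\<forall>i\<in>K - P. x $ i < 0" "x $ j < 0"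
      by (auto simp: X_def in_regions_iff)
    from P jP obtain y where y: "y \<in> W" "\<forall>i\<in>P. y $ i > 0" "\<forall>i\<in>K - P. y $ i < 0" "y $ j > 0"
      using j by (auto simp: Y_def in_regions_iff)
    \<comment> \<open>The combination with positive weights in which coordinate \<open>j\<close>
      cancels; the signs on \<open>K\<close>, common to \<open>x\<close> and \<open>y\<close>,
      survive.\<close>
    let ?z = "y $ j *\<^sub>R x + (- x $ j) *\<^sub>R y"
    have "?z \<in> W \<inter> vanishing {j}"
      using subspace_add[OF W subspace_scale[OF W x(1)] subspace_scale[OF W y(1)], of "y $ j" "- x $ j"]
      by (simp add: vanishing_def)
    moreover have "\<forall>i\<in>P. ?z $ i > 0"
    proof
      fix i assume "i \<in> P"
      then have "y $ j * x $ i > 0" "- x $ j * y $ i > 0"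
        using x y by (auto simp: mult_neg_pos)
      then show "?z $ i > 0" by simp
    qed
    moreover have "\<forall>i\<in>K - P. ?z $ i < 0"
    proof
      fix i assume "i \<in> K - P"
      then have "y $ j * x $ i < 0" "- x $ j * y $ i < 0"
        using x y by (auto simp: mult_pos_neg mult_neg_neg)
      then show "?z $ i < 0" by simp
    qed
    ultimately show "P \<in> regions (W \<inter> vanishing {j}) K"
      using PK unfolding in_regions_iff by blast
  next
    fix P assume P: "P \<in> regions (W \<inter> vanishing {j}) K"
    then obtain x where x: "x \<in> W" "x $ j = 0" "\<forall>i\<in>P. x $ i > 0" "\<forall>i\<in>K - P. x $ i < 0"
      and PK: "P \<subseteq> K"
      by (auto simp: in_regions_iff vanishing_def)
    obtain u where u: "u \<in> W" "u $ j > 0"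
    proof (cases "v $ j > 0")
      case False
      then show thesis using v W that[of "- v"] by (auto simp: subspace_neg)
    qed (use v that in auto)
    \<comment> \<open>Moves from the hyperplane in the opposite directions \<open>u\<close> and
      \<open>- u\<close> reach both sides within the same cell.\<close>
    obtain e where e: "e > 0" "\<forall>i\<in>P. (x + e *\<^sub>R u) $ i > 0" "\<forall>i\<in>K - P. (x + e *\<^sub>R u) $ i < 0"
      by (rule small_perturbation[OF x(3,4)])
    obtain d where d: "d > 0" "\<forall>i\<in>P. (x + d *\<^sub>R (- u)) $ i > 0" "\<forall>i\<in>K - P. (x + d *\<^sub>R (- u)) $ i < 0"
      by (rule small_perturbation[OF x(3,4)])
    define y where "y = x + e *\<^sub>R u"
    define z where "z = x + d *\<^sub>R (- u)"
    have "y \<in> W" "z \<in> W"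
      unfolding y_def z_def by (intro subspace_add subspace_scale subspace_neg W x u)+
    moreover have "y $ j > 0" "z $ j < 0"
      using x u e d by (simp_all add: y_def z_def)
    moreover note e d
    ultimately have yz: "y \<in> W" "y $ j > 0" "\<forall>i\<in>P. y $ i > 0" "\<forall>i\<in>K - P. y $ i < 0"
      "z \<in> W" "z $ j < 0" "\<forall>i\<in>P. z $ i > 0" "\<forall>i\<in>K - P. z $ i < 0"
      by (simp_all only: y_def z_def)
    have "insert j P \<in> ?R"
      unfolding in_regions_iff using PK yz(1-4) by (intro conjI bexI[of _ y]) auto
    moreover have "P \<in> ?R"
      unfolding in_regions_iff using PK yz(5-8) by (intro conjI bexI[of _ z]) auto
    ultimately show "P \<in> X \<inter> Y"
      using jK[OF P] by (simp add: X_def Y_def)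
  qed
  ultimately show ?thesis
    using R card_Un_Int[OF fin fin, of X Y] by simp
qed

lemma regions_trivial:
  assumes "dim W = 0" "K \<noteq> {}"
  shows "regions W K = {}"
proof -
  have "W \<subseteq> {0}" using assms(1) by simp
  then show ?thesis using assms(2) by (force simp: regions_def)
qed

text \<open>Pascal's rule added up over \<open>l\<close>. In \<open>card_regions\<close> the two
  sums on the right count the cells of the deletion and of the restriction.\<close>

lemma sum_choose_Suc:
  "(\<Sum>l<Suc d. Suc q choose l) = (\<Sum>l<Suc d. q choose l) + (\<Sum>l<d. q choose l)"
proof (induction d)
  case (Suc d)
  have "(\<Sum>l<Suc (Suc d). Suc q choose l) = (\<Sum>l<Suc d. Suc q choose l) + (Suc q choose Suc d)"
    by (rule sum.lessThan_Suc)
  then show ?case using Suc.IH by simp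
qed simp

text \<open>The Cover--Schlaefli count, by deletion and restriction of one hyperplane; the step is
  Pascal's rule.\<close>

lemma card_regions:
  fixes W :: "(real ^ 'N) set"
  assumes "finite K" "K \<noteq> {}" "subspace W"
    and "\<And>I. I \<subseteq> K \<Longrightarrow> dim (W \<inter> vanishing I) = dim W - card I"
  shows "card (regions W K) = 2 * (\<Sum>l<dim W. (card K - 1) choose l)"
  using assms
proof (induction K arbitrary: W rule: finite_ne_induct)
  case (singleton j)
  show ?case
  proof (cases "dim W")
    case 0
    then show ?thesis using regions_trivial[OF 0, of "{j}"] unfolding 0 by simp
  next
    case (Suc d)
    then have "dim (W \<inter> vanishing {j}) \<noteq> dim W"
      using singleton.prems(2)[of "{j}"] by simp
    then have "\<not> W \<subseteq> vanishing {j}"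
      by (metis Int_absorb2)
    then obtain v where v: "v \<in> W" "v $ j \<noteq> 0"
      by (auto simp: vanishing_def)
    \<comment> \<open>Without hyperplanes the whole subspace is the only cell, so a single
      hyperplane gives 1 + 1 cells.\<close>
    have "regions V {} = {{}}" if "0 \<in> V" for V :: "(real ^ 'N) set"
      using that by (auto simp: regions_def)
    then have "card (regions W {j}) = 2"
      using card_regions_insert[OF singleton.prems(1) v, of "{}"]
        subspace_0[OF singleton.prems(1)] by (simp add: vanishing_def)
    moreover have "(\<Sum>l<Suc d. 0 choose l) = 1"
      by (induction d) simp_all
    ultimately show ?thesis using Suc by simp
  qed
next
  case (insert j K)
  show ?case
  proof (cases "dim W")
    case 0
    then show ?thesis using regions_trivial[OF 0, of "insert j K"] unfolding 0 by simp
  next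
    case (Suc d)
    let ?V = "W \<inter> vanishing {j}"
    have dV: "dim ?V = d"
      using insert.prems(2)[of "{j}"] Suc by simp
    then have "?V \<noteq> W" using Suc by auto
    then obtain v where v: "v \<in> W" "v $ j \<noteq> 0"
      by (auto simp: vanishing_def)
    have "card (regions W K) = 2 * (\<Sum>l<dim W. (card K - 1) choose l)"
      by (rule insert.IH) (use insert.prems in auto)
    moreover have "card (regions ?V K) = 2 * (\<Sum>l<dim ?V. (card K - 1) choose l)"
    proof (rule insert.IH)
      show "subspace ?V"
        by (intro subspace_inter insert.prems subspace_vanishing)
      \<comment> \<open>The restriction inherits general position: cutting \<open>?V\<close> by
        \<open>I\<close> is cutting \<open>W\<close> by \<open>insert j I\<close>.\<close>
      fix I assume I: "I \<subseteq> K"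
      then have "?V \<inter> vanishing I = W \<inter> vanishing (insert j I)" "j \<notin> I" "finite I"
        using insert.hyps by (auto simp: vanishing_def finite_subset)
      then show "dim (?V \<inter> vanishing I) = dim ?V - card I"
        using insert.prems(2)[of "insert j I"] I dV Suc by auto
    qed
    moreover obtain q where q: "card K = Suc q"
      using insert.hyps by (metis card_0_eq not0_implies_Suc)
    moreover have "card (insert j K) = Suc (Suc q)"
      using insert.hyps q by simp
    ultimately show ?thesis
      using card_regions_insert[OF insert.prems(1) v insert.hyps(3)]
      by (simp only: Suc dV diff_Suc_1 sum_choose_Suc distrib_left)
  qed
qed

section \<open>Faces of linear images of the cube\<close>

text \<open>For disjoint \<open>Z\<close> and \<open>P\<close> this is the face on which a
  functional with zero set \<open>Z\<close> and positive set \<open>P\<close> is maximal;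
  \<open>Z\<close> holds the free coordinates.\<close>

definition cube_face :: "'N set \<Rightarrow> 'N set \<Rightarrow> (real ^ 'N) set" where
  "cube_face Z P = {x \<in> unit_hypercube. (\<forall>i\<in>P. x $ i = 1) \<and> (\<forall>i\<in>- (Z \<union> P). x $ i = 0)}"

lemma unit_hypercube_eq_cbox: "unit_hypercube = cbox 0 (1 :: real ^ 'N)"
  by (auto simp: unit_hypercube_def mem_box_cart)

lemma vanishing_eq_span:
  "vanishing (- Z) = span ((\<lambda>i. axis i (1::real)) ` Z)" for Z :: "'N::finite set"
proof
  show "span ((\<lambda>i. axis i (1::real)) ` Z) \<subseteq> vanishing (- Z)"
    by (intro span_minimal subspace_vanishing) (auto simp: vanishing_def axis_def)
  show "vanishing (- Z) \<subseteq> span ((\<lambda>i. axis i (1::real)) ` Z)"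
  proof
    fix x :: "real ^ 'N" assume x: "x \<in> vanishing (- Z)"
    have "x = (\<Sum>i\<in>UNIV. x $ i *\<^sub>R axis i 1)"
      by (simp add: vec_eq_iff axis_def if_distrib cong: if_cong)
    also have "\<dots> = (\<Sum>i\<in>Z. x $ i *\<^sub>R axis i 1)"
      by (rule sum.mono_neutral_right) (use x in \<open>auto simp: vanishing_def\<close>)
    also have "\<dots> \<in> span ((\<lambda>i. axis i (1::real)) ` Z)"
      by (intro span_sum span_scale span_base) auto
    finally show "x \<in> span ((\<lambda>i. axis i (1::real)) ` Z)" .
  qed
qed

lemma span_cube_face: "span (cube_face Z {}) = (vanishing (- Z) :: (real ^ 'N) set)"
proof
  show "span (cube_face Z {}) \<subseteq> (vanishing (- Z) :: (real ^ 'N) set)"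
    by (intro span_minimal subspace_vanishing) (auto simp: cube_face_def vanishing_def)
  show "(vanishing (- Z) :: (real ^ 'N) set) \<subseteq> span (cube_face Z {})"
    unfolding vanishing_eq_span
    by (intro span_mono) (auto simp: cube_face_def unit_hypercube_def axis_def)
qed

text \<open>Translation by the vertex \<open>p\<close> reduces to a face through the origin, where
  affine and linear dimension agree and the span is a coordinate subspace.\<close>

lemma aff_dim_image_cube_face:
  fixes A :: "real ^ 'N ^ 'n"
  assumes "Z \<inter> P = {}"
  shows "aff_dim ((*v) A ` cube_face Z P) = int (dim ((*v) A ` vanishing (- Z)))"
proof -
  define p :: "real ^ 'N" where "p = (\<chi> i. if i \<in> P then 1 else 0)"
  have "cube_face Z P = (+) p ` cube_face Z {}"
  proof (intro equalityI subsetI)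
    fix x assume "x \<in> cube_face Z P"
    then have "x - p \<in> cube_face Z {}"
      using assms by (auto simp: cube_face_def unit_hypercube_def p_def)
    then show "x \<in> (+) p ` cube_face Z {}"
      by (intro image_eqI[of _ _ "x - p"]) auto
  next
    fix x assume "x \<in> (+) p ` cube_face Z {}"
    then obtain y where y: "y \<in> cube_face Z {}" "x = p + y" by blast
    moreover have "y $ i = 0" if "i \<in> P" for i
      using y(1) that assms by (auto simp: cube_face_def)
    ultimately show "x \<in> cube_face Z P"
      using assms by (auto simp: cube_face_def unit_hypercube_def p_def)
  qed
  then have "(*v) A ` cube_face Z P = (+) (A *v p) ` (*v) A ` cube_face Z {}"
    by (simp add: image_image matrix_vector_right_distrib)
  then have "aff_dim ((*v) A ` cube_face Z P) = aff_dim ((*v) A ` cube_face Z {})"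
    by (simp add: aff_dim_translation_eq)
  also have "0 \<in> (*v) A ` cube_face Z {}"
    by (intro image_eqI[of _ _ 0]) (auto simp: cube_face_def unit_hypercube_def)
  then have "aff_dim ((*v) A ` cube_face Z {}) = int (dim ((*v) A ` cube_face Z {}))"
    by (intro aff_dim_zero hull_inc)
  also have "dim ((*v) A ` cube_face Z {}) = dim ((*v) A ` span (cube_face Z {}))"
    by (simp add: linear_span_image[symmetric])
  finally show ?thesis
    by (simp add: span_cube_face)
qed

text \<open>The gap between the bound and \<open>u \<bullet> x\<close> is a sum of nonnegative
  terms, one per coordinate. It is 0 only if every term is, which fixes each coordinate where
  \<open>u\<close> is nonzero.\<close>

lemma cube_face_maximizers:
  fixes u :: "real ^ 'N"
  assumes "x \<in> unit_hypercube"
  defines "Z \<equiv> {i. u $ i = 0}" and "P \<equiv> {i. u $ i > 0}"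
  shows "u \<bullet> x \<le> (\<Sum>i\<in>P. u $ i)" and "u \<bullet> x = (\<Sum>i\<in>P. u $ i) \<longleftrightarrow> x \<in> cube_face Z P"
proof -
  let ?t = "\<lambda>i. if i \<in> P then u $ i * (1 - x $ i) else - (u $ i * x $ i)"
  have "(\<Sum>i\<in>P. u $ i) = (\<Sum>i\<in>UNIV. if i \<in> P then u $ i else 0)"
    by (simp add: sum.If_cases)
  then have eq: "(\<Sum>i\<in>P. u $ i) - u \<bullet> x = (\<Sum>i\<in>UNIV. ?t i)"
    by (auto simp: inner_vec_def sum_subtractf[symmetric] algebra_simps intro!: sum.cong)
  have nn: "?t i \<ge> 0" for i
    using assms(1) by (auto simp: unit_hypercube_def P_def not_less mult_le_0_iff)
  then have "(\<Sum>i\<in>UNIV. ?t i) \<ge> 0" by (intro sum_nonneg) auto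
  then show "u \<bullet> x \<le> (\<Sum>i\<in>P. u $ i)" using eq by linarith
  have "u \<bullet> x = (\<Sum>i\<in>P. u $ i) \<longleftrightarrow> (\<Sum>i\<in>UNIV. ?t i) = 0"
    using eq by linarith
  also have "\<dots> \<longleftrightarrow> (\<forall>i. ?t i = 0)"
    using nn by (subst sum_nonneg_eq_0_iff) auto
  also have "\<dots> \<longleftrightarrow> x \<in> cube_face Z P"
    using assms(1) unfolding cube_face_def P_def Z_def
    by (auto split: if_splits)
  finally show "u \<bullet> x = (\<Sum>i\<in>P. u $ i) \<longleftrightarrow> x \<in> cube_face Z P" .
qed

lemma cube_face_inj:
  assumes "cube_face Z P = (cube_face Z' P' :: (real ^ 'N) set)" "Z \<inter> P = {}" "Z' \<inter> P' = {}"
  shows "Z = Z' \<and> P = P'"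
proof -
  have iff: "i \<in> P \<longleftrightarrow> (\<forall>x\<in>cube_face Z P. x $ i = 1)"
    "i \<notin> Z \<union> P \<longleftrightarrow> (\<forall>x\<in>cube_face Z P. x $ i = 0)"
    if "Z \<inter> P = {}" for i :: 'N and Z P
  proof -
    \<comment> \<open>Two vertices of the face, with all free coordinates 0 or all 1, witness that
      only \<open>P\<close> is constantly 1 and only the complement of \<open>Z \<union> P\<close>
      is constantly 0.\<close>
    have mem: "(\<chi> i. if i \<in> P then 1 else 0) \<in> cube_face Z P"
      "(\<chi> i. if i \<in> Z \<union> P then 1 else 0) \<in> cube_face Z P"
      by (simp_all add: cube_face_def unit_hypercube_def)
    have 1: "i \<in> P" if h: "\<forall>x\<in>cube_face Z P. x $ i = 1"
      using bspec[OF h mem(1)] by (simp split: if_splits)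
    have 2: "i \<notin> Z \<union> P" if h: "\<forall>x\<in>cube_face Z P. x $ i = 0"
      using bspec[OF h mem(2)] by (simp split: if_splits)
    have 3: "x $ i = 1" if "i \<in> P" "x \<in> cube_face Z P" for x
      using that by (simp add: cube_face_def)
    have 4: "x $ i = 0" if "i \<notin> Z \<union> P" "x \<in> cube_face Z P" for x
      using that by (simp add: cube_face_def)
    show "i \<in> P \<longleftrightarrow> (\<forall>x\<in>cube_face Z P. x $ i = 1)"
      using 1 3 by blast
    show "i \<notin> Z \<union> P \<longleftrightarrow> (\<forall>x\<in>cube_face Z P. x $ i = 0)"
      using 2 4 by blast
  qed
  have "i \<in> P \<longleftrightarrow> i \<in> P'" "i \<notin> Z \<union> P \<longleftrightarrow> i \<notin> Z' \<union> P'" for i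
    by (simp_all only: iff[OF assms(2)] iff[OF assms(3)] assms(1))
  then show ?thesis using assms(2,3) by blast
qed

section \<open>Sign vectors of the row space and faces of the zonotope\<close>

text \<open>Covectors in the sense of oriented matroids, as pairs of zero set and positive set; the
  negative set is what remains.\<close>

definition covectors :: "(real ^ 'N) set \<Rightarrow> ('N set \<times> 'N set) set" where
  "covectors L = {({i. u $ i = 0}, {i. u $ i > 0}) |u. u \<in> L}"

lemma row_space_eq_range: "row_space A = range (\<lambda>c. c v* A)" for A :: "real ^ 'N ^ 'n"
proof
  show "range (\<lambda>c. c v* A) \<subseteq> row_space A"
    using matrix_vector_mult_in_columnspace[of "transpose A"]
    by (auto simp: row_space_def)
  have lin: "linear (\<lambda>c. c v* A)"
    using matrix_vector_mul_linear[of "transpose A"] by simp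
  have "row i A = axis i 1 v* A" for i
    using matrix_vector_mult_basis[of "transpose A" i] by simp
  then show "row_space A \<subseteq> range (\<lambda>c. c v* A)"
    unfolding row_space_def rows_def
    by (intro span_minimal) (auto intro!: linear_subspace_image[OF lin subspace_UNIV])
qed

lemma in_covectors_row_space:
  "(Z, P) \<in> covectors (row_space A) \<longleftrightarrow>
    (\<exists>c. Z = {i. (c v* A) $ i = 0} \<and> P = {i. (c v* A) $ i > 0})"
  for A :: "real ^ 'N ^ 'n"
  unfolding covectors_def row_space_eq_range by blast

text \<open>Every face of the zonotope is exposed, and the maximizers over the cube of a functional
  that factors through \<open>A\<close> form the cube face given by its signs.\<close>

lemma num_faces_image_cube:
  fixes A :: "real ^ 'N ^ 'n"
  shows "num_faces k ((*v) A ` unit_hypercube) =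
    card {(Z, P) \<in> covectors (row_space A). dim ((*v) A ` vanishing (- Z)) = k}"
proof -
  let ?Q = "(*v) A ` unit_hypercube"
  let ?f = "\<lambda>(Z, P). (*v) A ` cube_face Z P"
  let ?C = "{(Z, P) \<in> covectors (row_space A). dim ((*v) A ` vanishing (- Z)) = k}"
  have disj: "Z \<inter> P = {}" if "(Z, P) \<in> covectors L" for Z P and L :: "(real ^ 'N) set"
    using that by (auto simp: covectors_def)
  have exposed: "?f (Z, P) = ?Q \<inter> {y. c \<bullet> y = b}" "\<And>y. y \<in> ?Q \<Longrightarrow> c \<bullet> y \<le> b"
    if "Z = {i. (c v* A) $ i = 0}" "P = {i. (c v* A) $ i > 0}" "b = (\<Sum>i\<in>P. (c v* A) $ i)"
    for Z P c b
    using cube_face_maximizers[of _ "c v* A"] unfolding that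
    by (auto simp: dot_lmul_matrix cube_face_def)
  have poly: "polytope ?Q"
    by (intro polytope_linear_image) (simp_all add: unit_hypercube_eq_cbox polytope_interval)
  have "bij_betw ?f ?C {F. F face_of ?Q \<and> aff_dim F = int k}"
    unfolding bij_betw_def
  proof (intro conjI equalityI subsetI)
    \<comment> \<open>The functional \<open>c\<close> takes its maximum on the image of
      \<open>cube_face Z P\<close>, so every cube point mapped there is a maximizer and lies in that
      cube face. Hence the image determines the cube face although \<open>A\<close> need not be
      injective.\<close>
    have sub: "cube_face Z' P' \<subseteq> cube_face Z P"
      if cov: "(Z, P) \<in> covectors (row_space A)" and eq: "?f (Z', P') = ?f (Z, P)" for Z P Z' P'
    proof -
      obtain c where c: "Z = {i. (c v* A) $ i = 0}" "P = {i. (c v* A) $ i > 0}"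
        using cov unfolding in_covectors_row_space by blast
      show ?thesis
      proof
        fix x assume x: "x \<in> cube_face Z' P'"
        then have "A *v x \<in> ?f (Z, P)" using eq by auto
        then have "c \<bullet> (A *v x) = (\<Sum>i\<in>P. (c v* A) $ i)"
          using exposed(1)[OF c refl] by blast
        then show "x \<in> cube_face Z P"
          using cube_face_maximizers(2)[of x "c v* A"] x c
          by (simp add: dot_lmul_matrix cube_face_def)
      qed
    qed
    show "inj_on ?f ?C"
    proof (rule inj_onI, clarify)
      fix Z P Z' P'
      assume ZP: "(Z, P) \<in> covectors (row_space A)" "(Z', P') \<in> covectors (row_space A)"
        and eq: "(*v) A ` cube_face Z P = (*v) A ` cube_face Z' P'"
      have "cube_face Z P = cube_face Z' P'"
        using sub[OF ZP(1), of Z' P'] sub[OF ZP(2), of Z P] eq by auto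
      then show "Z = Z' \<and> P = P'"
        using cube_face_inj disj[OF ZP(1)] disj[OF ZP(2)] by blast
    qed
  next
    fix F assume "F \<in> ?f ` ?C"
    then obtain Z P where ZP: "(Z, P) \<in> ?C" and F: "F = ?f (Z, P)" by blast
    then obtain c where c: "Z = {i. (c v* A) $ i = 0}" "P = {i. (c v* A) $ i > 0}"
      by (simp add: in_covectors_row_space) blast
    have "F face_of ?Q"
      unfolding F exposed(1)[OF c refl]
      by (intro face_of_Int_supporting_hyperplane_le exposed(2)[OF c refl] polytope_imp_convex poly)
    moreover have "aff_dim F = int k"
      using ZP disj aff_dim_image_cube_face[of Z P A] by (auto simp: F)
    ultimately show "F \<in> {F. F face_of ?Q \<and> aff_dim F = int k}" by simp
  next
    fix F assume F: "F \<in> {F. F face_of ?Q \<and> aff_dim F = int k}"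
    then have "F exposed_face_of ?Q"
      using poly by (simp add: exposed_face_of_polyhedron polytope_imp_polyhedron)
    then obtain c d where cd: "\<And>y. y \<in> ?Q \<Longrightarrow> c \<bullet> y \<le> d" "F = ?Q \<inter> {y. c \<bullet> y = d}"
      by (auto simp: exposed_face_of_def)
    define Z where "Z = {i. (c v* A) $ i = 0}"
    define P where "P = {i. (c v* A) $ i > 0}"
    define b where "b = (\<Sum>i\<in>P. (c v* A) $ i)"
    note e = exposed[OF Z_def P_def b_def]
    \<comment> \<open>\<open>F\<close> is nonempty because its dimension is not -1. So
      \<open>d\<close> is attained, as is \<open>b\<close> at a vertex of the cube face, and both
      are the maximum of \<open>c\<close>.\<close>
    have "F \<noteq> {}" using F by auto
    then obtain y where "y \<in> ?Q" "c \<bullet> y = d" using cd(2) by auto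
    then have "d \<le> b" using e(2) by auto
    have "(\<chi> i. if i \<in> P then 1 else 0) \<in> cube_face Z P"
      by (auto simp: cube_face_def unit_hypercube_def Z_def P_def)
    then obtain y' where "y' \<in> ?f (Z, P)" by blast
    then have "b \<le> d" using e(1) cd(1) by auto
    with \<open>d \<le> b\<close> have FZP: "F = ?f (Z, P)" using cd(2) e(1) by simp
    have cov: "(Z, P) \<in> covectors (row_space A)"
      by (auto simp: in_covectors_row_space Z_def P_def)
    have "dim ((*v) A ` vanishing (- Z)) = k"
      using aff_dim_image_cube_face[OF disj[OF cov], of A] F FZP by simp
    then show "F \<in> ?f ` ?C" using cov FZP by (intro image_eqI[of _ _ "(Z, P)"]) auto
  qed
  then show ?thesis
    unfolding num_faces_def by (rule bij_betw_same_card[symmetric])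
qed

section \<open>Dimensions of the faces and their number in general position\<close>

lemma subspace_row_space: "subspace (row_space A)" for A :: "real ^ 'N ^ 'n"
  by (simp add: row_space_def)

text \<open>The orthogonal complement of the image is \<open>?U\<close>. Full row rank makes
  \<open>?g\<close> injective, so \<open>?g\<close> carries \<open>?U\<close> isomorphically onto
  \<open>row_space A \<inter> vanishing Z\<close>.\<close>

lemma dim_image_vanishing:
  fixes A :: "real ^ 'N ^ 'n"
  assumes full: "dim (row_space A) = CARD('n)"
  shows "dim ((*v) A ` vanishing (- Z)) + dim (row_space A \<inter> vanishing Z) = CARD('n)"
proof -
  let ?V = "(*v) A ` vanishing (- Z)"
  let ?g = "\<lambda>c. c v* A"
  let ?U = "{c. ?g c \<in> vanishing Z}"
  have lin: "linear ?g"
    using matrix_vector_mul_linear[of "transpose A"] by simp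
  have "rank A = CARD('n)"
    using full by (simp only: row_rank_def row_space_def dim_span)
  then have "rank (transpose A) = CARD('n)"
    by (simp only: rank_transpose)
  moreover have "(*v) (transpose A) = ?g"
    by (rule ext) simp
  ultimately have inj: "inj ?g"
    by (simp only: full_rank_injective)
  have "{c \<in> UNIV. \<forall>y\<in>?V. orthogonal y c} = ?U"
  proof (intro equalityI subsetI)
    fix c assume c: "c \<in> {c \<in> UNIV. \<forall>y\<in>?V. orthogonal y c}"
    have "?g c $ i = 0" if "i \<in> Z" for i
    proof -
      have "axis i 1 \<in> vanishing (- Z)"
        using that by (auto simp: vanishing_def axis_def)
      then have "c \<bullet> (A *v axis i 1) = 0"
        using c by (auto simp: orthogonal_def inner_commute)
      then show ?thesis
        by (simp add: dot_lmul_matrix[symmetric] cart_eq_inner_axis)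
    qed
    then show "c \<in> ?U" by (simp add: vanishing_def)
  next
    fix c assume c: "c \<in> ?U"
    have "c \<bullet> (A *v x) = 0" if "x \<in> vanishing (- Z)" for x
    proof -
      have "?g c $ i * x $ i = 0" for i
        using c that by (cases "i \<in> Z") (auto simp: vanishing_def)
      then have "?g c \<bullet> x = 0"
        unfolding inner_vec_def by (intro sum.neutral) simp
      then show ?thesis
        by (simp only: dot_lmul_matrix)
    qed
    then show "c \<in> {c \<in> UNIV. \<forall>y\<in>?V. orthogonal y c}"
      by (auto simp: orthogonal_def inner_commute)
  qed
  then have "dim ?U + dim ?V = CARD('n)"
    using dim_subspace_orthogonal_to_vectors[of ?V UNIV]
      linear_subspace_image[OF matrix_vector_mul_linear subspace_vanishing, of A "- Z"] by simp
  moreover have "dim (?g ` ?U) = dim ?U"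
    by (intro dim_image_eq lin inj_on_subset[OF inj]) simp
  moreover have "?g ` ?U = row_space A \<inter> vanishing Z"
    by (auto simp: row_space_eq_range)
  ultimately show ?thesis by simp
qed

lemma num_faces_generic:
  fixes A :: "real ^ 'N ^ 'n"
  assumes gen: "generic_subspace (row_space A)" and full: "dim (row_space A) = CARD('n)"
    and k: "k < CARD('n)"
  shows "num_faces k ((*v) A ` unit_hypercube) =
    (CARD('N) choose k) * (2 * (\<Sum>l<CARD('n) - k. (CARD('N) - k - 1) choose l))"
proof -
  let ?L = "row_space A"
  let ?W = "\<lambda>Z. ?L \<inter> vanishing Z"
  have nN: "CARD('n) \<le> CARD('N)"
    using dim_subset_UNIV[of ?L] full by simp
  have dimW: "dim (?W Z) = CARD('n) - card Z" for Z
    using dim_Int_vanishing[OF gen] full by simp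
  \<comment> \<open>The image has dimension \<open>min (card Z) CARD('n)\<close>; as
    \<open>k < CARD('n)\<close>, larger zero sets cannot give dimension \<open>k\<close>.\<close>
  have "dim ((*v) A ` vanishing (- Z)) = k \<longleftrightarrow> card Z = k" for Z
    using dim_image_vanishing[OF full, of Z] dimW[of Z] k by auto
  moreover have "(Z, P) \<in> covectors ?L \<longleftrightarrow> P \<in> regions (?W Z) (- Z)" for Z P
  proof -
    have "Z = {i. u $ i = 0} \<and> P = {i. u $ i > 0} \<longleftrightarrow>
        u \<in> vanishing Z \<and> (\<forall>i\<in>- Z. u $ i \<noteq> 0) \<and> P = {i \<in> - Z. u $ i > 0}" for u :: "real ^ 'N"
      by (auto simp: vanishing_def)
    then show ?thesis
      unfolding covectors_def regions_def by blast
  qed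
  ultimately have "{(Z, P) \<in> covectors ?L. dim ((*v) A ` vanishing (- Z)) = k} =
      (SIGMA Z:{Z. card Z = k}. regions (?W Z) (- Z))"
    by auto
  moreover have "card (regions (?W Z) (- Z)) = 2 * (\<Sum>l<CARD('n) - k. (CARD('N) - k - 1) choose l)"
    if Z: "card Z = k" for Z
  proof -
    have cK: "card (- Z) = CARD('N) - k"
      using Z by (simp add: Compl_eq_Diff_UNIV card_Diff_subset)
    have "card (regions (?W Z) (- Z)) = 2 * (\<Sum>l<dim (?W Z). (card (- Z) - 1) choose l)"
    proof (rule card_regions)
      show "- Z \<noteq> {}" using cK k nN by (intro notI) simp
      show "subspace (?W Z)" by (intro subspace_inter subspace_row_space subspace_vanishing)
      fix I assume "I \<subseteq> - Z"
      then have "card (Z \<union> I) = k + card I"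
        using Z by (subst card_Un_disjoint) auto
      then show "dim (?W Z \<inter> vanishing I) = dim (?W Z) - card I"
        using dimW[of Z] dimW[of "Z \<union> I"] Z by (simp add: vanishing_Un Int_assoc)
    qed simp
    then show ?thesis by (simp add: dimW cK Z)
  qed
  moreover have "card {Z :: 'N set. card Z = k} = CARD('N) choose k"
    using n_subsets[of "UNIV :: 'N set" k] by simp
  ultimately show ?thesis
    by (simp add: num_faces_image_cube)
qed

text \<open>The cube is its own image under the identity, whose row space is everything and hence
  generic. The inner sum is then a full row of Pascal's triangle.\<close>

lemma num_faces_unit_hypercube:
  assumes k: "k < CARD('N)"
  shows "num_faces k (unit_hypercube :: (real ^ 'N) set) = (CARD('N) choose k) * 2 ^ (CARD('N) - k)"
proof -
  let ?I = "mat 1 :: real ^ 'N ^ 'N"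
  have L: "row_space ?I = UNIV"
    by (simp add: row_space_eq_range)
  have "vanishing S = {0}" if "card S = CARD('N)" for S :: "'N set"
  proof -
    have "S = UNIV" using that by (intro card_subset_eq) auto
    then show ?thesis by simp
  qed
  then have "generic_subspace (row_space ?I)"
    unfolding L generic_subspace_def by auto
  then have "num_faces k (unit_hypercube :: (real ^ 'N) set) =
      (CARD('N) choose k) * (2 * (\<Sum>l<CARD('N) - k. (CARD('N) - k - 1) choose l))"
    using num_faces_generic[of ?I k] k by (simp add: L)
  moreover obtain q where q: "CARD('N) - k = Suc q"
    using k by (metis Suc_diff_Suc)
  ultimately show ?thesis
    using choose_row_sum[of q] by (simp add: q lessThan_Suc_atMost)
qed

section \<open>General position of the row space\<close>

text \<open>A vector of the null space supported on \<open>J\<close> is a linear relation among the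
  columns indexed by \<open>J\<close>; two equal columns also give one.\<close>

lemma independent_columns_iff:
  fixes A :: "real ^ 'N ^ 'n"
  shows "inj_on (\<lambda>j. column j A) J \<and> independent ((\<lambda>j. column j A) ` J) \<longleftrightarrow>
    (\<forall>x\<in>vanishing (- J). A *v x = 0 \<longrightarrow> x = 0)"
proof (intro iffI ballI impI)
  let ?c = "\<lambda>j. column j A"
  fix x assume *: "inj_on ?c J \<and> independent (?c ` J)"
    and x: "x \<in> vanishing (- J)" "A *v x = 0"
  have "0 = (\<Sum>j\<in>UNIV. x $ j *\<^sub>R ?c j)"
    using x(2) by (simp add: matrix_mult_sum scalar_mult_eq_scaleR)
  also have "\<dots> = (\<Sum>j\<in>J. x $ j *\<^sub>R ?c j)"
    by (rule sum.mono_neutral_right) (use x in \<open>auto simp: vanishing_def\<close>)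
  \<comment> \<open>Injectivity allows the coefficients to be indexed by the columns themselves, as
    \<open>independentD\<close> requires.\<close>
  also have "\<dots> = (\<Sum>v\<in>?c ` J. x $ (the_inv_into J ?c v) *\<^sub>R v)"
    by (simp add: sum.reindex[OF conjunct1[OF *]] the_inv_into_f_f[OF conjunct1[OF *]])
  finally have "x $ (the_inv_into J ?c v) = 0" if "v \<in> ?c ` J" for v
    using independentD[OF conjunct2[OF *], of "?c ` J" "\<lambda>v. x $ (the_inv_into J ?c v)" v] that
    by simp
  then have "x $ j = 0" if "j \<in> J" for j
    using * that by (metis imageI the_inv_into_f_f)
  then show "x = 0"
    using x(1) by (auto simp: vec_eq_iff vanishing_def)
next
  assume *: "\<forall>x\<in>vanishing (- J). A *v x = 0 \<longrightarrow> x = 0"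
  let ?e = "\<lambda>j::'N. axis j (1::real)"
  have inj: "inj_on ((*v) A) (vanishing (- J))"
  proof (rule inj_onI)
    fix x y assume "x \<in> vanishing (- J)" "y \<in> vanishing (- J)" "A *v x = A *v y"
    then have "x - y \<in> vanishing (- J)" "A *v (x - y) = 0"
      by (auto intro: subspace_diff[OF subspace_vanishing] simp: matrix_vector_mult_diff_distrib)
    then have "x - y = 0" using * by blast
    then show "x = y" by simp
  qed
  have "independent (?e ` J)"
    by (rule independent_mono[OF independent_Basis]) (auto simp: Basis_vec_def)
  then have "independent ((*v) A ` ?e ` J)"
    by (intro linear_independent_injective_image matrix_vector_mul_linear)
      (use inj in \<open>simp_all add: vanishing_eq_span\<close>)
  moreover have "inj_on ?e J"
    by (auto simp: inj_on_def axis_eq_axis)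
  moreover have "inj_on ((*v) A) (?e ` J)"
    by (rule inj_on_subset[OF inj]) (simp add: vanishing_eq_span span_superset)
  ultimately show "inj_on (\<lambda>j. column j A) J \<and> independent ((\<lambda>j. column j A) ` J)"
    using comp_inj_on[of ?e J "(*v) A"]
    by (simp add: matrix_vector_mult_basis image_image comp_def)
qed

lemma nullspace_eq_orthogonal_comp: "nullspace A = orthogonal_comp (row_space A)"
  for A :: "real ^ 'N ^ 'n"
proof -
  have "A *v x = 0 \<longleftrightarrow> (\<forall>c. (c v* A) \<bullet> x = 0)" for x
    unfolding dot_lmul_matrix by (metis inner_eq_zero_iff inner_zero_right)
  then show ?thesis
    by (auto simp: nullspace_def orthogonal_comp_def row_space_eq_range orthogonal_def)
qed

text \<open>Orthogonal complements turn the hypothesis into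
  \<open>row_space A = nullspace B\<close>. A vector there that vanishes on \<open>CARD('n)\<close>
  coordinates is a relation among the remaining \<open>CARD('m)\<close> columns of \<open>B\<close>,
  hence 0. The dimension follows since \<open>B\<close> has full row rank.\<close>

lemma generic_row_space:
  fixes A :: "real ^ 'N ^ 'n" and B :: "real ^ 'N ^ 'm"
  assumes card: "CARD('n) + CARD('m) = CARD('N)"
    and null: "nullspace A = row_space B"
    and indep: "\<And>J. card J = CARD('m) \<Longrightarrow>
      inj_on (\<lambda>j. column j B) J \<and> independent ((\<lambda>j. column j B) ` J)"
  shows "generic_subspace (row_space A)" and "dim (row_space A) = CARD('n)"
proof -
  have eq: "row_space A = nullspace B"
    using null nullspace_eq_orthogonal_comp[of A] nullspace_eq_orthogonal_comp[of B]
      orthogonal_comp_self[OF subspace_row_space, of A] by simp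
  obtain J :: "'N set" where J: "card J = CARD('m)"
    using card obtain_subset_with_card_n[of "CARD('m)" "UNIV :: 'N set"] by auto
  have "CARD('m) \<le> dim (columns B)"
    using indep[OF J] J independent_card_le_dim[of "(\<lambda>j. column j B) ` J" "columns B"]
    by (auto simp: card_image columns_def)
  then have "dim (row_space B) = CARD('m)"
    using rank_bound[of B] column_rank_def[of B] row_rank_def[of B] by (simp add: row_space_def)
  moreover have "nullspace B = {y \<in> UNIV. \<forall>x\<in>row_space B. orthogonal x y}"
    by (simp add: nullspace_eq_orthogonal_comp orthogonal_comp_def)
  ultimately show dim: "dim (row_space A) = CARD('n)"
    using dim_subspace_orthogonal_to_vectors[OF subspace_row_space[of B] subspace_UNIV] card
    by (simp add: eq)
  have "nullspace B \<inter> vanishing S = {0}" if "card S = CARD('n)" for S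
  proof -
    have "card (- S) = CARD('m)" using that card by (simp add: Compl_eq_Diff_UNIV card_Diff_subset)
    then have "\<forall>x\<in>vanishing S. B *v x = 0 \<longrightarrow> x = 0"
      using indep[of "- S"] independent_columns_iff[of B "- S"] by simp
    then show ?thesis by (auto simp: nullspace_def vanishing_def)
  qed
  then show "generic_subspace (row_space A)"
    unfolding generic_subspace_def dim by (simp add: eq subspace_row_space[of A, unfolded eq])
qed

section \<open>Measurability of the number of faces\<close>

text \<open>The image is the span of the columns in \<open>Z\<close>. Choosing a basis among them
  reduces the dimension to finitely many independence conditions, whose measurability is easier to
  see.\<close>

lemma dim_image_vanishing_ge_iff:
  fixes A :: "real ^ 'N ^ 'n"
  shows "k \<le> dim ((*v) A ` vanishing (- Z)) \<longleftrightarrow>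
    (\<exists>I\<subseteq>Z. card I = k \<and> (\<forall>x\<in>vanishing (- I). A *v x = 0 \<longrightarrow> x = 0))"
proof -
  let ?c = "\<lambda>j. column j A"
  have "(*v) A ` vanishing (- Z) = span (?c ` Z)"
    unfolding vanishing_eq_span
    by (simp add: linear_span_image[symmetric] image_image matrix_vector_mult_basis)
  then have dim: "dim ((*v) A ` vanishing (- Z)) = dim (?c ` Z)"
    by simp
  have "k \<le> dim (?c ` Z) \<longleftrightarrow> (\<exists>I\<subseteq>Z. card I = k \<and> inj_on ?c I \<and> independent (?c ` I))"
  proof
    assume k: "k \<le> dim (?c ` Z)"
    obtain C where C: "C \<subseteq> ?c ` Z" "independent C" "card C = dim (?c ` Z)"
      using basis_exists[of "?c ` Z"] by metis
    then obtain J where J: "J \<subseteq> Z" "inj_on ?c J" "C = ?c ` J"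
      by (auto simp: subset_image_inj)
    then have "k \<le> card J" using k C by (simp add: card_image)
    then obtain I where I: "I \<subseteq> J" "card I = k"
      using obtain_subset_with_card_n by blast
    then have "inj_on ?c I" "?c ` I \<subseteq> C"
      using J by (auto intro: inj_on_subset)
    then have "inj_on ?c I" "independent (?c ` I)"
      using independent_mono[OF C(2)] by auto
    then show "\<exists>I\<subseteq>Z. card I = k \<and> inj_on ?c I \<and> independent (?c ` I)"
      using I J by blast
  next
    assume "\<exists>I\<subseteq>Z. card I = k \<and> inj_on ?c I \<and> independent (?c ` I)"
    then obtain I where I: "I \<subseteq> Z" "card I = k" "inj_on ?c I" "independent (?c ` I)" by blast
    then have "card (?c ` I) \<le> dim (?c ` Z)"
      by (intro independent_card_le_dim image_mono)
    then show "k \<le> dim (?c ` Z)" using I by (simp add: card_image)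
  qed
  then show ?thesis
    by (simp add: dim independent_columns_iff)
qed

lemma closed_projection_compact:
  fixes K :: "'a::euclidean_space set" and Q :: "'a \<Rightarrow> 'b::euclidean_space \<Rightarrow> bool"
  assumes "compact K" "closed {p. Q (fst p) (snd p)}"
  shows "closed {y. \<exists>x\<in>K. Q x y}"
  using closed_compact_projection[OF assms] by (simp add: Bex_def)

text \<open>The set is open: a nontrivial relation can be normalized to the unit sphere, so the
  complement is the projection of a closed set along a compact one.\<close>

lemma sets_independent_columns:
  "{A :: real ^ 'N ^ 'n. \<forall>x\<in>vanishing (- I). A *v x = 0 \<longrightarrow> x = 0} \<in> sets borel"
proof -
  let ?C = "{A :: real ^ 'N ^ 'n. \<exists>x\<in>sphere 0 1 \<inter> vanishing (- I). A *v x = 0}"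
  have "closed ?C"
  proof (rule closed_projection_compact)
    show "compact (sphere 0 1 \<inter> vanishing (- I))"
      by (intro compact_Int_closed closed_subspace subspace_vanishing) simp
    show "closed {p :: (real ^ 'N) \<times> (real ^ 'N ^ 'n). snd p *v fst p = 0}"
      unfolding matrix_vector_mult_def
      by (intro closed_Collect_eq continuous_intros)
  qed
  moreover have "{A :: real ^ 'N ^ 'n. \<forall>x\<in>vanishing (- I). A *v x = 0 \<longrightarrow> x = 0} = - ?C"
  proof -
    have "\<exists>y\<in>sphere 0 1 \<inter> vanishing (- I). A *v y = 0"
      if "x \<in> vanishing (- I)" "A *v x = 0" "x \<noteq> 0" for x and A :: "real ^ 'N ^ 'n"
    proof
      show "x /\<^sub>R norm x \<in> sphere 0 1 \<inter> vanishing (- I)"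
        using that by (simp add: subspace_scale[OF subspace_vanishing])
      show "A *v (x /\<^sub>R norm x) = 0"
        using that(2) by (simp add: matrix_vector_mult_scaleR)
    qed
    moreover have "x \<noteq> 0" if "x \<in> sphere 0 1" for x :: "real ^ 'N"
      using that by auto
    ultimately show ?thesis by blast
  qed
  ultimately show ?thesis by (simp add: borel_comp borel_closed)
qed

lemma sets_dim_image_vanishing:
  "{A :: real ^ 'N ^ 'n. dim ((*v) A ` vanishing (- Z)) = k} \<in> sets borel"
proof -
  have ge: "{A :: real ^ 'N ^ 'n. k \<le> dim ((*v) A ` vanishing (- Z))} \<in> sets borel" for k
  proof -
    have "{A :: real ^ 'N ^ 'n. k \<le> dim ((*v) A ` vanishing (- Z))} =
        (\<Union>I\<in>{I. I \<subseteq> Z \<and> card I = k}. {A. \<forall>x\<in>vanishing (- I). A *v x = 0 \<longrightarrow> x = 0})"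
      by (auto simp: dim_image_vanishing_ge_iff)
    also have "\<dots> \<in> sets borel"
      by (intro sets.finite_UN sets_independent_columns) simp
    finally show ?thesis .
  qed
  have "{A :: real ^ 'N ^ 'n. dim ((*v) A ` vanishing (- Z)) = k} =
      {A. k \<le> dim ((*v) A ` vanishing (- Z))} - {A. Suc k \<le> dim ((*v) A ` vanishing (- Z))}"
    by auto
  then show ?thesis using ge by (simp add: sets.Diff)
qed

text \<open>By scaling the witness, the nonzero signs may be required to have absolute value at least
  one, so the set is a countable union of projections of closed sets along compact balls.\<close>

lemma sets_covector:
  "{A :: real ^ 'N ^ 'n. (Z, P) \<in> covectors (row_space A)} \<in> sets borel"
proof -
  let ?Q = "\<lambda>(c :: real ^ 'n) (A :: real ^ 'N ^ 'n). \<forall>i. (i \<in> Z \<longrightarrow> (c v* A) $ i = 0) \<and>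
    (i \<in> P \<longrightarrow> 1 \<le> (c v* A) $ i) \<and> (i \<notin> Z \<union> P \<longrightarrow> (c v* A) $ i \<le> -1)"
  have "(Z, P) \<in> covectors (row_space A) \<longleftrightarrow> (\<exists>n::nat. \<exists>c\<in>cball 0 (real n). ?Q c A)" for A
  proof
    assume "(Z, P) \<in> covectors (row_space A)"
    then obtain c where c: "Z = {i. (c v* A) $ i = 0}" "P = {i. (c v* A) $ i > 0}"
      by (simp add: in_covectors_row_space) blast
    \<comment> \<open>Scaling by \<open>t\<close> brings every nonzero coordinate to absolute value
      at least 1, since \<open>t\<close> bounds each reciprocal. Zero coordinates add nothing, as
      \<open>1 / 0 = 0\<close>.\<close>
    define t where "t = (\<Sum>i\<in>UNIV. 1 / \<bar>(c v* A) $ i\<bar>)"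
    have t: "1 \<le> t * \<bar>(c v* A) $ i\<bar>" if "(c v* A) $ i \<noteq> 0" for i
    proof -
      have "1 / \<bar>(c v* A) $ i\<bar> \<le> t"
        unfolding t_def by (rule member_le_sum) auto
      then show ?thesis using that by (simp add: field_simps)
    qed
    have scale: "((t *\<^sub>R c) v* A) $ i = t * (c v* A) $ i" for i
      by (simp add: vector_matrix_mult_def sum_distrib_left mult_ac)
    have "?Q (t *\<^sub>R c) A"
    proof (intro allI conjI impI)
      fix i
      show "i \<in> Z \<Longrightarrow> ((t *\<^sub>R c) v* A) $ i = 0"
        by (simp add: scale c)
      show "i \<in> P \<Longrightarrow> 1 \<le> ((t *\<^sub>R c) v* A) $ i"
        using t[of i] by (simp add: scale c)
      show "i \<notin> Z \<union> P \<Longrightarrow> ((t *\<^sub>R c) v* A) $ i \<le> -1"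
        using t[of i] by (simp add: scale c)
    qed
    moreover obtain n :: nat where "norm (t *\<^sub>R c) \<le> real n"
      using real_arch_simple by blast
    ultimately show "\<exists>n::nat. \<exists>c\<in>cball 0 (real n). ?Q c A"
      by (intro exI[of _ n] bexI[of _ "t *\<^sub>R c"]) auto
  next
    assume "\<exists>n::nat. \<exists>c\<in>cball 0 (real n). ?Q c A"
    then obtain c where Q: "?Q c A" by blast
    have "(i \<in> Z \<longleftrightarrow> (c v* A) $ i = 0) \<and> (i \<in> P \<longleftrightarrow> (c v* A) $ i > 0)" for i
      using spec[OF Q, of i] by auto
    then show "(Z, P) \<in> covectors (row_space A)"
      unfolding in_covectors_row_space by blast
  qed
  then have "{A :: real ^ 'N ^ 'n. (Z, P) \<in> covectors (row_space A)} =
      (\<Union>n::nat. {A. \<exists>c\<in>cball 0 (real n). ?Q c A})"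
    by auto
  also have "\<dots> \<in> sets borel"
  proof (intro sets.countable_UN image_subsetI borel_closed closed_projection_compact compact_cball)
    show "closed {p. ?Q (fst p) (snd p)}"
      unfolding vector_matrix_mult_def vec_lambda_beta
      by (intro closed_Collect_all closed_Collect_conj closed_Collect_imp open_Collect_const
          closed_Collect_le closed_Collect_eq continuous_intros)
  qed
  finally show ?thesis .
qed

text \<open>The count is a finite sum, over all pairs of coordinate sets, of indicators of Borel
  sets of matrices.\<close>

lemma borel_measurable_num_faces:
  "(\<lambda>A :: real ^ 'N ^ 'n. real (num_faces k ((*v) A ` unit_hypercube))) \<in> borel_measurable borel"
proof -
  let ?S = "\<lambda>Z P. {A :: real ^ 'N ^ 'n. (Z, P) \<in> covectors (row_space A)} \<inter>
    {A. dim ((*v) A ` vanishing (- Z)) = k}"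
  have "real (num_faces k ((*v) A ` unit_hypercube)) =
      (\<Sum>(Z, P)\<in>UNIV. indicator (?S Z P) A)" for A :: "real ^ 'N ^ 'n"
  proof -
    have "(\<Sum>(Z, P)\<in>UNIV. indicator (?S Z P) A) =
        (\<Sum>q\<in>UNIV. if q \<in> {(Z, P) \<in> covectors (row_space A). dim ((*v) A ` vanishing (- Z)) = k}
          then 1 else 0 :: real)"
      by (intro sum.cong) (auto simp: indicator_def)
    moreover have "(\<Sum>q\<in>UNIV. if q \<in> T then 1 else 0) = real (card T)" for T :: "('N set \<times> 'N set) set"
      by (simp add: sum.If_cases)
    ultimately show ?thesis by (simp only: num_faces_image_cube)
  qed
  moreover have "(\<lambda>A. \<Sum>(Z, P)\<in>UNIV. indicator (?S Z P) A :: real) \<in> borel_measurable borel"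
    unfolding case_prod_beta
    by (intro borel_measurable_sum borel_measurable_indicator sets.Int sets_covector
        sets_dim_image_vanishing)
  ultimately show ?thesis by simp
qed

section \<open>The expected number of faces\<close>

text \<open>Reflecting \<open>l\<close> to \<open>q - l\<close> turns the sum in
  \<open>Pcoeff\<close> into the upper part \<open>{d..q}\<close> of row \<open>q\<close> of
  Pascal's triangle. The row sums to \<open>2 ^ q\<close>, so the lower part is left.\<close>

lemma one_minus_Pcoeff:
  assumes "n < N" "k < n"
  shows "1 - Pcoeff (N - n) (N - k) = (\<Sum>l<n - k. real ((N - k - 1) choose l)) / 2 ^ (N - k - 1)"
proof -
  define q where "q = N - k - 1"
  define d where "d = n - k"
  have L: "N - k = Suc q" and m: "N - n = Suc q - d" and d: "0 < d" "d \<le> q"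
    using assms by (auto simp: q_def d_def)
  let ?c = "\<lambda>l. real (q choose l)"
  have powi: "2 powi (- int (Suc q) + 1) = (1 / 2 ^ q :: real)"
    by (simp add: power_int_minus power_int_of_nat inverse_eq_divide)
  have top: "(\<Sum>l = 0..Suc q - d - 1. ?c l) = (\<Sum>l\<in>{d..q}. ?c l)"
    by (rule sum.reindex_bij_witness[of _ "\<lambda>l. q - l" "\<lambda>l. q - l"])
      (use d in \<open>auto simp: binomial_symmetric[symmetric]\<close>)
  have total: "2 ^ q = (\<Sum>l<d. ?c l) + (\<Sum>l\<in>{d..q}. ?c l)"
  proof -
    have "2 ^ q = (\<Sum>l\<le>q. ?c l)"
      using choose_row_sum[of q] by (metis of_nat_numeral of_nat_power of_nat_sum)
    also have "{..q} = {..<d} \<union> {d..q}" using d by auto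
    finally show ?thesis by (simp add: sum.union_disjoint ivl_disj_int)
  qed
  have frac: "1 - 1 / p * y = x / p" if "p = x + y" "p \<noteq> 0" for p x y :: real
    using that by (simp add: field_simps)
  show ?thesis
    unfolding Pcoeff_def L m d_def[symmetric] diff_Suc_1 powi top
    by (rule frac[OF total]) simp
qed

theorem theorem1p11:
  fixes M :: "'a measure"
    and A :: "'a \<Rightarrow> real ^ 'N ^ 'n"
    and B :: "'a \<Rightarrow> real ^ 'N ^ 'm"
    and k :: nat
  assumes "prob_space M"
    and "k < CARD('n)" and "CARD('n) < CARD('N)"
    and "A \<in> borel_measurable M"
    and "orthant_symmetric_generic_nullspace M A B"
  shows "prob_space.expectation M
           (\<lambda>\<omega>. real (num_faces k ((\<lambda>x. A \<omega> *v x) ` (unit_hypercube :: (real ^ 'N) set))))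
         / real (num_faces k (unit_hypercube :: (real ^ 'N) set))
       = 1 - Pcoeff (CARD('N) - CARD('n)) (CARD('N) - k)"
proof -
  interpret prob_space M by fact
  let ?f = "\<lambda>\<omega>. real (num_faces k ((*v) (A \<omega>) ` unit_hypercube))"
  let ?s = "\<Sum>l<CARD('n) - k. (CARD('N) - k - 1) choose l"
  let ?r = "real ((CARD('N) choose k) * (2 * ?s))"
  have card: "CARD('n) + CARD('m) = CARD('N)" and gen: "generic_columns M B"
    and null: "AE \<omega> in M. nullspace (A \<omega>) = row_space (B \<omega>)"
    using assms(5) by (simp_all add: orthant_symmetric_generic_nullspace_def)
  \<comment> \<open>There are only finitely many \<open>J\<close>, so one null set serves them
    all.\<close>
  have "AE \<omega> in M. \<forall>J\<in>{J. card J = CARD('m)}.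
      inj_on (\<lambda>j. column j (B \<omega>)) J \<and> independent ((\<lambda>j. column j (B \<omega>)) ` J)"
    by (rule AE_finite_allI) (use gen in \<open>auto simp: generic_columns_def\<close>)
  then have "AE \<omega> in M. ?f \<omega> = ?r"
    using null
  proof eventually_elim
    case (elim \<omega>)
    then have "generic_subspace (row_space (A \<omega>))" "dim (row_space (A \<omega>)) = CARD('n)"
      using generic_row_space[OF card elim(2)] by auto
    then show ?case
      using num_faces_generic assms(2) by metis
  qed
  moreover have "?f \<in> borel_measurable M"
    using measurable_compose[OF assms(4) borel_measurable_num_faces] .
  ultimately have "expectation ?f = expectation (\<lambda>_. ?r)"
    by (intro integral_cong_AE) auto
  then have E: "expectation ?f = ?r"
    by (simp add: prob_space)
  obtain q where q: "CARD('N) - k = Suc q"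
    using assms(2,3) by (metis Suc_diff_Suc less_trans)
  \<comment> \<open>The binomial coefficient cancels, and the factor 2 for the cells lowers the
    power of 2 by one.\<close>
  have "?r / real ((CARD('N) choose k) * 2 ^ (CARD('N) - k)) = real ?s / 2 ^ (CARD('N) - k - 1)"
    using assms(2,3) unfolding q by (simp add: field_simps)
  then show ?thesis
    using assms(2,3) by (simp only: E num_faces_unit_hypercube one_minus_Pcoeff of_nat_sum less_trans)
qed

end
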